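(* Let $f\in C(\mathbb{R},S^1)$ be a pre-periodic function and let $\tilde f$ be a lift of $f$. Then the limit $$\lim_{x\to+\infty}\frac{\tilde f(x)-\tilde f(-x)}{2x}$$ exists and is a rational number.
   Context: $S^1=\{z\in\mathbb{C}:|z|=1\}$. A function $f\in C(\mathbb{R},S^1)$ is called pre-periodic if for every $\varepsilon>0$ there exists a positive integer $N$ such that $|f(x+kN)-f(x)|<\varepsilon$ for all $k\in\mathbb{Z}$ and all $x\in\mathbb{R}$. A lift of $f$ is a continuous function $\tilde f:\mathbb{R}\to\mathbb{R}$ with $e^{2\pi i\tilde f(x)}=f(x)$ for all $x\in\mathbb{R}$. (The limit is called the generalized winding number of $f$ and denoted $\#f$.) *)

theory Defs
  imports "HOL-Analysis.Analysis"
begin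

definition pre_periodic :: "(real \<Rightarrow> complex) \<Rightarrow> bool" where
  "pre_periodic f \<longleftrightarrow>
     (\<forall>\<epsilon>>0. \<exists>N::nat. N > 0 \<and>
        (\<forall>(k::int) (x::real). norm (f (x + of_int k * of_nat N) - f x) < \<epsilon>))"

definition is_lift :: "(real \<Rightarrow> complex) \<Rightarrow> (real \<Rightarrow> real) \<Rightarrow> bool" where
  "is_lift f g \<longleftrightarrow>
     continuous_on UNIV g \<and> (\<forall>x. exp (2 * of_real pi * \<i> * of_real (g x)) = f x)"

end

theory Submission imports Defs
begin

text \<open>Take a period \<open>N\<close> for \<open>\<epsilon> = 1\<close>. For each \<open>k\<close>, the difference
  \<open>g (x + k N) - g x\<close> stays close to \<open>\<int>\<close>, hence close to a single integer \<open>m\<^sub>k\<close> by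
  connectedness. As \<open>m\<^sub>k\<close> is additive up to an error less than 1, it is exactly additive,
  so \<open>m\<^sub>k = k m\<^sub>1\<close>. Consequently \<open>g x - (m\<^sub>1 / N) x\<close> is bounded, and the limit is \<open>m\<^sub>1 / N\<close>.\<close>

text \<open>The real part of the exponential is \<open>cos (2 * pi * t)\<close>, which must be
  positive. It depends only on the offset \<open>s\<close> of \<open>t\<close> from its nearest
  integer. As cosine decreases on \<open>[0, pi]\<close> and vanishes at \<open>pi/2\<close>,
  \<open>s\<close> is less than a quarter in size.\<close>

lemma near_int_if_exp_near_1:
  fixes t :: real
  assumes "norm (exp (2 * of_real pi * \<i> * of_real t) - 1) < 1"
  shows "\<exists>m::int. \<bar>t - of_int m\<bar> < 1/4"
proof -
  define s where "s = t - of_int (round t)"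
  have s: "\<bar>s\<bar> \<le> 1/2"
    using of_int_round_abs_le[of t] by (simp add: s_def abs_minus_commute)
  have "\<bar>Re (exp (2 * of_real pi * \<i> * of_real t) - 1)\<bar> < 1"
    using abs_Re_le_cmod assms by (rule le_less_trans)
  then have "cos (2 * pi * t) > 0"
    by (simp add: Re_exp)
  moreover have "cos (2 * pi * t) = cos (2 * pi * s)"
    by (simp add: s_def right_diff_distrib cos_diff)
  ultimately have pos: "cos (2 * pi * \<bar>s\<bar>) > 0"
    by (cases "s \<ge> 0") auto
  have "\<bar>s\<bar> < 1/4"
  proof (rule ccontr)
    assume "\<not> \<bar>s\<bar> < 1/4"
    then have "pi/2 \<le> 2 * pi * \<bar>s\<bar>" "2 * pi * \<bar>s\<bar> \<le> pi"
      using s pi_gt_zero by (simp_all add: field_simps)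
    then have "cos (2 * pi * \<bar>s\<bar>) \<le> cos (pi/2)"
      by (intro cos_monotone_0_pi_le) auto
    with pos show False by simp
  qed
  then show ?thesis unfolding s_def by blast
qed

text \<open>Passing from one integer to another would force \<open>h\<close> through a half-integer
  by connectedness, but a half-integer is at distance at least 1/2 from every integer.\<close>

lemma continuous_near_int_constant:
  fixes h :: "real \<Rightarrow> real"
  assumes cont: "continuous_on UNIV h"
    and near: "\<And>x. \<exists>m::int. \<bar>h x - of_int m\<bar> < 1/4"
  shows "\<exists>m::int. \<forall>x. \<bar>h x - of_int m\<bar> < 1/4"
proof -
  have conn: "connected (range h)"
    using cont by (rule connected_continuous_image) simp
  have le: "m \<le> n" if "\<bar>h x - of_int m\<bar> < 1/4" "\<bar>h y - of_int n\<bar> < 1/4"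
    for x y and m n :: int
  proof (rule ccontr)
    assume "\<not> m \<le> n"
    then have mn: "n + 1 \<le> m" by simp
    then have "real_of_int n + 1 \<le> of_int m" by linarith
    with that have "of_int n + 1/2 \<in> {h y..h x}" by (simp, linarith)
    moreover have "{h y..h x} \<subseteq> range h"
      using conn by (rule connected_contains_Icc) auto
    ultimately obtain z where z: "h z = of_int n + 1/2"
      by (metis imageE subsetD)
    obtain p :: int where "\<bar>h z - of_int p\<bar> < 1/4" using near by blast
    then have "real_of_int p < of_int (n + 1)" "real_of_int n < of_int p"
      unfolding z by linarith+
    then show False by (simp only: of_int_less_iff)
  qed
  obtain m :: int where m: "\<bar>h 0 - of_int m\<bar> < 1/4" using near by blast
  have "\<bar>h x - of_int m\<bar> < 1/4" for x
  proof -
    obtain n :: int where n: "\<bar>h x - of_int n\<bar> < 1/4" using near by blast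
    with le[OF m n] le[OF n m] show ?thesis by simp
  qed
  then show ?thesis by blast
qed

theorem theorem4p5:
  fixes f :: "real \<Rightarrow> complex" and g :: "real \<Rightarrow> real"
  assumes "continuous_on UNIV f"
    and "\<And>x. f x \<in> sphere 0 1"
    and "pre_periodic f"
    and "is_lift f g"
  shows "\<exists>L\<in>\<rat>. ((\<lambda>x. (g x - g (- x)) / (2 * x)) \<longlongrightarrow> L) at_top"
proof -
  have contg: "continuous_on UNIV g"
    and lift: "\<And>x. exp (2 * of_real pi * \<i> * of_real (g x)) = f x"
    using assms(4) by (auto simp: is_lift_def)
  obtain N :: nat where N: "N > 0"
    and per: "\<And>(k::int) x. norm (f (x + of_int k * of_nat N) - f x) < 1"
    using assms(3) unfolding pre_periodic_def by (metis zero_less_one)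
  have "\<exists>m::int. \<forall>x. \<bar>g (x + of_int k * of_nat N) - g x - of_int m\<bar> < 1/4" for k :: int
  proof (rule continuous_near_int_constant)
    show "continuous_on UNIV (\<lambda>x. g (x + of_int k * of_nat N) - g x)"
      by (intro continuous_intros continuous_on_compose2[OF contg]) (auto intro: contg)
  next
    fix x :: real
    let ?y = "x + of_int k * of_nat N"
    \<comment> \<open>Since \<open>f x\<close> has modulus 1, the distance of this quotient from 1
      is exactly \<open>norm (f ?y - f x)\<close>, which \<open>per\<close> bounds by 1.\<close>
    have "exp (2 * of_real pi * \<i> * of_real (g ?y - g x)) = f ?y / f x"
      unfolding lift[symmetric] exp_diff[symmetric] by (simp add: algebra_simps)
    moreover have "norm (f x) = 1" using assms(2)[of x] by simp
    moreover from this have "f ?y / f x - 1 = (f ?y - f x) / f x"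
      by (auto simp: diff_divide_distrib)
    ultimately have "norm (exp (2 * of_real pi * \<i> * of_real (g ?y - g x)) - 1)
        = norm (f ?y - f x)"
      by (simp only: norm_divide div_by_1)
    then show "\<exists>m::int. \<bar>g ?y - g x - of_int m\<bar> < 1/4"
      using per[of x k] by (intro near_int_if_exp_near_1) simp
  qed
  then obtain M :: "int \<Rightarrow> int"
    where M: "\<And>k x. \<bar>g (x + of_int k * of_nat N) - g x - of_int (M k)\<bar> < 1/4"
    by metis
  have add: "M (k + l) = M k + M l" for k l
  proof -
    \<comment> \<open>The shift from 0 to \<open>b\<close> is split at \<open>a\<close>. Three
      errors below 1/4 add up to less than 1, so the integers agree.\<close>
    define a b where "a = real_of_int l * of_nat N" and "b = a + of_int k * of_nat N"
    have "of_int (k + l) * of_nat N = b"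
      by (simp add: a_def b_def algebra_simps)
    then have "\<bar>g b - g 0 - of_int (M (k + l))\<bar> < 1/4" "\<bar>g a - g 0 - of_int (M l)\<bar> < 1/4"
      using M[of 0 "k + l"] M[of 0 l] by (simp_all only: a_def add_0)
    moreover have "\<bar>g b - g a - of_int (M k)\<bar> < 1/4"
      unfolding b_def by (rule M)
    ultimately have "\<bar>real_of_int (M (k + l)) - of_int (M k) - of_int (M l)\<bar> < 1"
      by linarith
    then show ?thesis by linarith
  qed
  have "M 0 = 0" using add[of 0 0] by simp
  then have M_linear: "M k = k * M 1" for k
  proof (induction k rule: int_induct[where k = 0])
    case (step1 i) then show ?case using add[of i 1] by (simp add: algebra_simps)
  next
    case (step2 i) then show ?case using add[of "i - 1" 1] by (simp add: algebra_simps)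
  qed simp
  define L where "L = real_of_int (M 1) / of_nat N"
  define D where "D x = g x - L * x" for x
  \<comment> \<open>The slope \<open>L\<close> is chosen so that the linear term gains exactly
    \<open>M k\<close> over \<open>k\<close> periods, leaving only the error term.\<close>
  have D_shift: "\<bar>D (x + of_int k * of_nat N) - D x\<bar> < 1/4" for k :: int and x
  proof -
    have "L * (x + of_int k * of_nat N) = L * x + of_int (M k)"
      using N by (simp add: M_linear[of k] L_def distrib_left)
    then show ?thesis using M[where x=x and k=k] by (simp only: D_def)
  qed
  have "compact (D ` {0..of_nat N})"
    unfolding D_def
    by (intro compact_continuous_image continuous_intros continuous_on_subset[OF contg]) auto
  then obtain B where B: "\<And>x. x \<in> {0..of_nat N} \<Longrightarrow> \<bar>D x\<bar> \<le> B"
    by (fastforce dest!: compact_imp_bounded simp: bounded_iff)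
  have D_bound: "\<bar>D x\<bar> \<le> B + 1/4" for x
  proof -
    \<comment> \<open>Going back \<open>k\<close> periods lands in \<open>{0..of_nat N}\<close>,
      where \<open>B\<close> applies; by \<open>D_shift\<close> this costs at most 1/4, however
      large \<open>k\<close> is.\<close>
    define k where "k = \<lfloor>x / of_nat N\<rfloor>"
    have "of_int k \<le> x / of_nat N" "x / of_nat N \<le> of_int k + 1"
      unfolding k_def by linarith+
    then have "x - of_int k * of_nat N \<in> {0..of_nat N}"
      using N by (simp add: field_simps)
    from B[OF this] D_shift[of "x - of_int k * of_nat N" k] show ?thesis
      by (simp only: diff_add_cancel)
  qed
  have "((\<lambda>x. (D x - D (- x)) / (2 * x)) \<longlongrightarrow> 0) at_top"
  proof (rule Lim_null_comparison)
    show "\<forall>\<^sub>F x in at_top. norm ((D x - D (- x)) / (2 * x)) \<le> (B + 1/4) / x"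
      using eventually_gt_at_top[of 0]
    proof eventually_elim
      case (elim x)
      have "\<bar>D x - D (- x)\<bar> \<le> 2 * (B + 1/4)"
        using D_bound[of x] D_bound[of "- x"] abs_triangle_ineq4[of "D x" "D (- x)"]
        by argo
      with elim show ?case by (simp add: field_simps)
    qed
    show "((\<lambda>x. (B + 1/4) / x) \<longlongrightarrow> 0) at_top"
      by (intro tendsto_divide_0[OF tendsto_const] filterlim_at_top_imp_at_infinity filterlim_ident)
  qed
  then have "((\<lambda>x. L + (D x - D (- x)) / (2 * x)) \<longlongrightarrow> L) at_top"
    by (rule tendsto_add[OF tendsto_const, where b = 0, simplified])
  \<comment> \<open>The linear part of \<open>g\<close> contributes \<open>2 * L * x\<close> to the
    numerator, hence exactly \<open>L\<close> once \<open>x\<close> is nonzero.\<close>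
  moreover have "\<forall>\<^sub>F x in at_top. L + (D x - D (- x)) / (2 * x) = (g x - g (- x)) / (2 * x)"
    using eventually_gt_at_top[of 0]
    by eventually_elim (simp add: D_def field_simps)
  ultimately have "((\<lambda>x. (g x - g (- x)) / (2 * x)) \<longlongrightarrow> L) at_top"
    by (rule Lim_transform_eventually)
  moreover have "L \<in> \<rat>" by (simp add: L_def)
  ultimately show ?thesis by blast
qed

end
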